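(* Let $m\geq 2$. Then $D(P_{2m+1,2})=m+1$.
   Context: For positive integers $n,k$ with $2\le 2k<n$, the generalised Petersen graph $P_{n,k}$ has vertex set $\{u_i,v_i: i\in\{0,\dots,n-1\}\}$ and edge set $\{u_iu_{i+1}, v_iv_{i+k}, u_iv_i : i\in\{0,\dots,n-1\}\}$, indices modulo $n$. A signed graph $(G,E_-)$ is a simple graph $G$ with a set $E_-\subseteq E(G)$ of negative edges; other edges are positive. A cycle is positive if the product of its edge signs is positive; a signed graph is balanced if every cycle is positive. The frustration index $l(G,E_-)$ is the minimum number of edges whose deletion leaves a balanced signed graph, and the maximum frustration is $D(G)=\max_{E_-\subseteq E(G)} l(G,E_-)$. *)

theory Defs
  imports Main
begin

text \<open>Undirected graphs are given by a vertex set and a set of two-element sets as edges.\<close>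

record 'a ugraph =
  verts :: "'a set"
  edges :: "'a set set"

definition simple_graph :: "'a ugraph \<Rightarrow> bool" where
  "simple_graph G \<longleftrightarrow> (\<forall>e \<in> edges G. e \<subseteq> verts G \<and> card e = 2)"

definition delete_edges :: "'a ugraph \<Rightarrow> 'a set set \<Rightarrow> 'a ugraph" where
  "delete_edges G F = \<lparr>verts = verts G, edges = edges G - F\<rparr>"

text \<open>A cycle is represented by the list of its vertices in cyclic order, without repeating the
  first one at the end. Since the list is distinct and of length at least three, its edges
  are pairwise distinct, so the product of the signs can be taken over the edge set.\<close>

definition cycle_edges :: "'a list \<Rightarrow> 'a set set" where
  "cycle_edges vs = {{vs ! i, vs ! (Suc i mod length vs)} |i. i < length vs}"

definition is_cycle :: "'a ugraph \<Rightarrow> 'a list \<Rightarrow> bool" where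
  "is_cycle G vs \<longleftrightarrow>
     3 \<le> length vs \<and> distinct vs \<and> set vs \<subseteq> verts G \<and> cycle_edges vs \<subseteq> edges G"

text \<open>A signed graph is a simple graph \<open>G\<close> together with a set \<open>N \<subseteq> edges G\<close> of negative edges.\<close>

definition edge_sign :: "'a set set \<Rightarrow> 'a set \<Rightarrow> int" where
  "edge_sign N e = (if e \<in> N then -1 else 1)"

definition positive_cycle :: "'a set set \<Rightarrow> 'a list \<Rightarrow> bool" where
  "positive_cycle N vs \<longleftrightarrow> (\<Prod>e \<in> cycle_edges vs. edge_sign N e) > 0"

definition balanced :: "'a ugraph \<Rightarrow> 'a set set \<Rightarrow> bool" where
  "balanced G N \<longleftrightarrow> (\<forall>vs. is_cycle G vs \<longrightarrow> positive_cycle N vs)"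

text \<open>The next two definitions are meant for graphs with finitely many edges; the sets whose
  minimum and maximum are taken are then finite, and nonempty.\<close>

definition frustration_index :: "'a ugraph \<Rightarrow> 'a set set \<Rightarrow> nat" where
  "frustration_index G N =
     Min (card ` {F. F \<subseteq> edges G \<and> balanced (delete_edges G F) (N - F)})"

definition max_frustration :: "'a ugraph \<Rightarrow> nat" where
  "max_frustration G = Max (frustration_index G ` Pow (edges G))"

datatype petersen_vertex = U nat | V nat

text \<open>Intended for \<open>2 \<le> 2 * k < n\<close>.\<close>

definition gen_petersen :: "nat \<Rightarrow> nat \<Rightarrow> petersen_vertex ugraph" where
  "gen_petersen n k =
     \<lparr>verts = U ` {..<n} \<union> V ` {..<n},
      edges = {{U i, U ((i + 1) mod n)} |i. i < n}
            \<union> {{V i, V ((i + k) mod n)} |i. i < n}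
            \<union> {{U i, V i} |i. i < n}\<rparr>"

lemma finite_edges_gen_petersen: "finite (edges (gen_petersen n k))"
  by (simp add: gen_petersen_def)

lemma simple_graph_gen_petersen:
  assumes "2 \<le> 2 * k" "2 * k < n"
  shows "simple_graph (gen_petersen n k)"
proof -
  have *: "(i + j) mod n \<noteq> i" if "i < n" "0 < j" "j < n" for i j
    using that by (cases "i + j < n") (auto simp: mod_if)
  have "(i + 1) mod n \<noteq> i" "(i + k) mod n \<noteq> i" if "i < n" for i
    using *[OF that, of 1] *[OF that, of k] assms by auto
  then show ?thesis
    using assms unfolding simple_graph_def gen_petersen_def
    by (fastforce simp: card_insert_if)
qed

lemma is_cycle_delete_edges: "is_cycle (delete_edges G F) vs \<Longrightarrow> is_cycle G vs"
  by (auto simp: is_cycle_def delete_edges_def)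

lemma balanced_delete_all_edges: "balanced (delete_edges G (edges G)) N"
proof -
  have "cycle_edges vs \<noteq> {}" if "3 \<le> length vs" for vs :: "'a list"
    using that unfolding cycle_edges_def by (auto intro!: exI[of _ 0])
  then show ?thesis
    by (auto simp: balanced_def is_cycle_def delete_edges_def)
qed

end

(* Lower bound: with all edges negative, the 2m+1 pentagons u_i u_{i+1} u_{i+2} v_{i+2} v_i are
   negative and every edge lies on at most two of them, so at least m+1 deletions are needed.

   Upper bound: the outer cycle and these pentagons generate the cycle space. Hence a signing can be
   replaced, without changing the sign of any cycle, by one whose set of negative outer edges P and
   set of negative spokes D are arbitrary up to the parity of P; the inner edge v_i v_{i+2} is then
   negative iff the sign of the i-th pentagon is not already accounted for. If some pentagon r is
   positive, pair up the remaining ones as {r+1,r+2}, {r+3,r+4}, ...: each pair is settled by at most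
   one negative edge, and spending one more edge on a single pair corrects the parity of P (two more
   if all pentagons are positive, when nothing else is spent). If all pentagons are negative, m outer
   edges and one inner edge do, or m-1 outer edges, one spoke and one inner edge, which realises the
   other parity. *)
theory Submission
  imports Defs
begin

section \<open>Cyclic index arithmetic and the edges of a cycle\<close>

lemma add_mod_neq:
  fixes i :: nat
  assumes "i < n" "0 < k" "k < n"
  shows "(i + k) mod n \<noteq> i"
  using assms by (cases "i + k < n") (auto simp: mod_if)

text \<open>Rules out that the \<open>k\<close>-step edges starting at \<open>i\<close> and at
  \<open>i + k\<close> are one edge read in opposite directions.\<close>

lemma add_mod_twice_neq:
  fixes i :: nat
  assumes "i < n" "0 < k" "2 * k < n"
  shows "((i + k) mod n + k) mod n \<noteq> i"
  using add_mod_neq[of i n "2 * k"] assms by (simp add: mod_simps mult_2 add.assoc)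

text \<open>Equal edges with crossed endpoints would make two cyclic steps return to their start,
  impossible for length at least three.\<close>

lemma inj_on_cycle_edge:
  assumes "3 \<le> length vs" "distinct vs"
  shows "inj_on (\<lambda>i. {vs ! i, vs ! (Suc i mod length vs)}) {..<length vs}"
proof (rule inj_onI)
  fix i j
  assume ij: "i \<in> {..<length vs}" "j \<in> {..<length vs}"
    and eq: "{vs ! i, vs ! (Suc i mod length vs)} = {vs ! j, vs ! (Suc j mod length vs)}"
  have lt: "Suc i mod length vs < length vs" "Suc j mod length vs < length vs"
    using ij by (auto intro!: mod_less_divisor)
  have "i = j \<or> i = Suc j mod length vs \<and> Suc i mod length vs = j"
    using eq ij lt assms(2) by (auto simp: doubleton_eq_iff nth_eq_iff_index_eq)
  then show "i = j"
    using add_mod_twice_neq[of j "length vs" 1] ij assms(1) by auto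
qed

lemma cycle_edges_image:
  "cycle_edges vs = (\<lambda>i. {vs ! i, vs ! (Suc i mod length vs)}) ` {..<length vs}"
  by (auto simp: cycle_edges_def)

lemma card_cycle_edges:
  assumes "3 \<le> length vs" "distinct vs"
  shows "card (cycle_edges vs) = length vs"
  unfolding cycle_edges_image using card_image[OF inj_on_cycle_edge[OF assms]] by simp

lemma sum_rotate_Suc:
  fixes f :: "nat \<Rightarrow> 'a::comm_monoid_add"
  shows "(\<Sum>i<n. f (Suc i mod n)) = (\<Sum>i<n. f i)"
proof (cases n)
  case (Suc p)
  have "(\<Sum>i<Suc p. f (Suc i mod Suc p)) = (\<Sum>i<p. f (Suc i mod Suc p)) + f 0"
    by simp
  also have "(\<Sum>i<p. f (Suc i mod Suc p)) = (\<Sum>i<p. f (Suc i))"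
    by (intro sum.cong) auto
  finally show ?thesis
    unfolding Suc sum.lessThan_Suc_shift[of f p] by (simp add: add.commute)
qed simp

lemma sum_rotate:
  fixes f :: "nat \<Rightarrow> 'a::comm_monoid_add"
  shows "(\<Sum>i<n. f ((i + k) mod n)) = (\<Sum>i<n. f i)"
proof (induction k)
  case 0
  show ?case by (intro sum.cong) auto
next
  case (Suc k)
  show ?case
    using sum_rotate_Suc[of "\<lambda>i. f ((i + k) mod n)" n] Suc by (simp add: mod_simps)
qed

lemma prod_rotate_Suc:
  fixes f :: "nat \<Rightarrow> 'a::comm_monoid_mult"
  shows "(\<Prod>i<n. f (Suc i mod n)) = (\<Prod>i<n. f i)"
proof (cases n)
  case (Suc p)
  have "(\<Prod>i<Suc p. f (Suc i mod Suc p)) = (\<Prod>i<p. f (Suc i mod Suc p)) * f 0"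
    by simp
  also have "(\<Prod>i<p. f (Suc i mod Suc p)) = (\<Prod>i<p. f (Suc i))"
    by (intro prod.cong) auto
  finally show ?thesis
    unfolding Suc prod.lessThan_Suc_shift[of f p] by (simp add: mult.commute)
qed simp

section \<open>Balance by vertex potentials\<close>

text \<open>One direction of Harary's criterion: each edge sign is the product of the two signs of
  its ends, and around a cycle every vertex sign occurs twice.\<close>

lemma balanced_if_potential:
  fixes s :: "'a \<Rightarrow> bool"
  assumes "\<And>x y. {x, y} \<in> edges G \<Longrightarrow> {x, y} \<in> N \<longleftrightarrow> s x \<noteq> s y"
  shows "balanced G N"
  unfolding balanced_def
proof (intro allI impI)
  fix vs
  assume cyc: "is_cycle G vs"
  let ?n = "length vs" and ?\<sigma> = "\<lambda>x. if s x then -1 else (1::int)"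
  let ?e = "\<lambda>i. {vs ! i, vs ! (Suc i mod ?n)}"
  have n: "3 \<le> ?n" "distinct vs" "cycle_edges vs \<subseteq> edges G"
    using cyc by (auto simp: is_cycle_def)
  have "(\<Prod>e \<in> cycle_edges vs. edge_sign N e) = (\<Prod>i<?n. edge_sign N (?e i))"
    unfolding cycle_edges_image by (simp add: prod.reindex[OF inj_on_cycle_edge[OF n(1,2)]])
  also have "\<dots> = (\<Prod>i<?n. ?\<sigma> (vs ! i) * ?\<sigma> (vs ! (Suc i mod ?n)))"
  proof (intro prod.cong refl)
    fix i assume "i \<in> {..<?n}"
    then have "?e i \<in> edges G" using n(3) unfolding cycle_edges_image by blast
    from assms[OF this]
    show "edge_sign N (?e i) = ?\<sigma> (vs ! i) * ?\<sigma> (vs ! (Suc i mod ?n))"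
      by (auto simp: edge_sign_def)
  qed
  \<comment> \<open>Rotating the index in the second factor turns the product into a square.\<close>
  also have "\<dots> = (\<Prod>i<?n. ?\<sigma> (vs ! i)) * (\<Prod>i<?n. ?\<sigma> (vs ! i))"
    by (simp only: prod.distrib prod_rotate_Suc[of "\<lambda>i. ?\<sigma> (vs ! i)"])
  also have "\<dots> > 0"
    unfolding power2_eq_square[symmetric] zero_less_power2 by simp
  finally show "positive_cycle N vs"
    by (simp add: positive_cycle_def)
qed

lemma frustration_index_le_if_potential:
  fixes s :: "'a \<Rightarrow> bool"
  assumes fin: "finite (edges G)" and F: "F \<subseteq> edges G"
    and s: "\<And>x y. {x, y} \<in> edges G - F \<Longrightarrow> {x, y} \<in> N \<longleftrightarrow> s x \<noteq> s y"
  shows "frustration_index G N \<le> card F"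
proof -
  have "balanced (delete_edges G F) (N - F)"
    by (rule balanced_if_potential[where s = s]) (use s in \<open>auto simp: delete_edges_def\<close>)
  then show ?thesis
    unfolding frustration_index_def using fin F by (intro Min_le) auto
qed

lemma frustration_index_attained:
  assumes "finite (edges G)"
  obtains F where "F \<subseteq> edges G" "balanced (delete_edges G F) (N - F)"
    "card F = frustration_index G N"
proof -
  let ?S = "{F. F \<subseteq> edges G \<and> balanced (delete_edges G F) (N - F)}"
  have "finite (card ` ?S)" "card ` ?S \<noteq> {}"
    using assms balanced_delete_all_edges[of G "N - edges G"] by auto
  then have "frustration_index G N \<in> card ` ?S"
    unfolding frustration_index_def by (rule Min_in)
  then show ?thesis using that by auto
qed

section \<open>Cheap signings with prescribed pentagon and outer cycle signs\<close>

lemma sum_pairs: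
  fixes f :: "nat \<Rightarrow> nat"
  shows "(\<Sum>i<2 * m + 1. f i) = f 0 + (\<Sum>k<m. f (2 * k + 1) + f (2 * k + 2))"
  by (induction m) (auto simp: algebra_simps)

text \<open>Modulo 2, the size of a symmetric difference is the sum of the sizes.\<close>

lemma odd_sum_of_bool_neq:
  fixes n :: nat
  shows "odd (\<Sum>i<n. of_bool (p i \<noteq> q i) :: nat) \<longleftrightarrow>
     odd (\<Sum>i<n. of_bool (p i) :: nat) \<noteq> odd (\<Sum>i<n. of_bool (q i) :: nat)"
  by (induction n) auto

text \<open>In the next three lemmas, \<open>T i\<close> says that the \<open>i\<close>-th pentagon is negative,
  and \<open>b\<close> that the outer cycle is.\<close>

lemma cheap_outer_set_zero:
  fixes T :: "nat \<Rightarrow> bool"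
  assumes m: "2 \<le> m" and T0: "\<not> T 0"
  obtains P where "odd (\<Sum>i<2 * m + 1. of_bool (P i) :: nat) \<longleftrightarrow> b"
    "(\<Sum>i<2 * m + 1. of_bool (P i)
        + of_bool (T i \<noteq> (P i \<noteq> P (Suc i mod (2 * m + 1))))) \<le> m + 1"
proof -
  \<comment> \<open>\<open>k0\<close> is the pair at which the parity will be corrected. It contains
    a negative pentagon whenever some pair does, since the correction is cheapest there.\<close>
  obtain k0 where k0: "k0 < m" and k0T: "\<And>k. k < m \<Longrightarrow> T (2 * k + 1) \<or> T (2 * k + 2) \<Longrightarrow>
      T (2 * k0 + 1) \<or> T (2 * k0 + 2)"
  proof (cases "\<exists>k<m. T (2 * k + 1) \<or> T (2 * k + 2)")
    case True
    then show ?thesis using that by blast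
  next
    case False
    then show ?thesis using that[of 0] m by auto
  qed
  define Q where "Q k \<longleftrightarrow> T (2 * k + 1) \<and> T (2 * k + 2)" for k
  define flip where "flip \<longleftrightarrow> odd (\<Sum>k<m. of_bool (Q k) :: nat) \<noteq> b"
  define R where "R k \<longleftrightarrow> Q k \<noteq> (k = k0 \<and> flip)" for k
  \<comment> \<open>Outer edge \<open>2 * k + 2\<close> lies on exactly the pentagons
    \<open>2 * k + 1\<close> and \<open>2 * k + 2\<close>, so one such edge settles a pair with both
    negative; \<open>R k\<close> decides whether it is used.\<close>
  define P where "P i \<longleftrightarrow> i \<noteq> 0 \<and> even i \<and> R (i div 2 - 1)" for i
  have [simp]: "P 0 = False" "P (Suc (2 * k)) = False" "P (Suc (Suc (2 * k))) = R k"
    "P (Suc 0) = False" for k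
    by (auto simp: P_def)
  have [simp]: "P (Suc (Suc (Suc (2 * k))) mod Suc (2 * m)) = False" if "k < m" for k
  proof -
    have "Suc (Suc (Suc (2 * k))) mod Suc (2 * m) = (if Suc k = m then 0 else Suc (2 * Suc k))"
      using that by (auto simp: mod_if)
    then show ?thesis by (simp del: mult_Suc_right)
  qed
  have sumP: "(\<Sum>i<2 * m + 1. of_bool (P i) :: nat) = (\<Sum>k<m. of_bool (R k))"
    unfolding sum_pairs by simp
  have one: "(\<Sum>k<m. of_bool (k = k0 \<and> flip) :: nat) = of_bool flip"
    using k0 by (simp add: of_bool_conj sum.delta)
  have par: "odd (\<Sum>i<2 * m + 1. of_bool (P i) :: nat) \<longleftrightarrow> b"
    unfolding sumP R_def odd_sum_of_bool_neq one by (auto simp: flip_def)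
  let ?c = "\<lambda>k. of_bool (R k) + of_bool (T (2 * k + 1) \<noteq> R k) + of_bool (T (2 * k + 2) \<noteq> R k) :: nat"
  \<comment> \<open>Index 0 costs nothing: pentagon 0 is positive and \<open>P\<close> avoids outer
    edges 0 and 1.\<close>
  have cost: "(\<Sum>i<2 * m + 1. of_bool (P i)
        + of_bool (T i \<noteq> (P i \<noteq> P (Suc i mod (2 * m + 1))))) = (\<Sum>k<m. ?c k)"
    unfolding sum_pairs using T0 m by (auto intro!: sum.cong simp: add_ac)
  have "(\<Sum>k<m. ?c k) \<le> m + 1"
  proof (cases "\<exists>k<m. T (2 * k + 1) \<or> T (2 * k + 2)")
    case True
    then have "T (2 * k0 + 1) \<or> T (2 * k0 + 2)" using k0T by blast
    \<comment> \<open>The choice \<open>Q k\<close> costs at most 1; its negation costs 2 in a pair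
      with a negative pentagon.\<close>
    then have "(\<Sum>k<m. ?c k) \<le> (\<Sum>k<m. 1 + of_bool (k = k0 \<and> flip))"
      by (intro sum_mono) (auto simp: R_def Q_def)
    then show ?thesis unfolding sum.distrib one by (cases flip) simp_all
  next
    case False
    \<comment> \<open>Here a flip costs the outer edge and both inner edges of the pair, and 3 \<le>
      m + 1.\<close>
    then have "(\<Sum>k<m. ?c k) \<le> (\<Sum>k<m. 3 * of_bool (k = k0 \<and> flip))"
      by (intro sum_mono) (auto simp: R_def Q_def)
    then show ?thesis unfolding sum_distrib_left[symmetric] one using m by (cases flip) simp_all
  qed
  then show ?thesis using that[OF par] cost by simp
qed

lemma cheap_outer_set:
  fixes T :: "nat \<Rightarrow> bool"
  assumes m: "2 \<le> m" and r: "r < 2 * m + 1" "\<not> T r"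
  obtains P where "odd (\<Sum>i<2 * m + 1. of_bool (P i) :: nat) \<longleftrightarrow> b"
    "(\<Sum>i<2 * m + 1. of_bool (P i)
        + of_bool (T i \<noteq> (P i \<noteq> P (Suc i mod (2 * m + 1))))) \<le> m + 1"
proof -
  define n where "n = 2 * m + 1"
  have rn: "r < n" using r by (simp add: n_def)
  \<comment> \<open>Renumber cyclically so that the positive pentagon \<open>r\<close> becomes
    pentagon 0; cost and parity are invariant under rotation.\<close>
  define T' where "T' j = T ((j + r) mod n)" for j
  have "\<not> T' 0" using r by (simp add: T'_def n_def)
  from cheap_outer_set_zero[where T = T', OF m this, of b, folded n_def]
  obtain P where P: "odd (\<Sum>i<n. of_bool (P i) :: nat) \<longleftrightarrow> b"
    "(\<Sum>i<n. of_bool (P i) + of_bool (T' i \<noteq> (P i \<noteq> P (Suc i mod n)))) \<le> m + 1"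
    by blast
  \<comment> \<open>The inverse rotation; adding \<open>n - r\<close> avoids truncated
    subtraction.\<close>
  let ?h = "\<lambda>i. (i + (n - r)) mod n"
  have T': "T' (?h i) = T i" if "i < n" for i
    using that rn by (simp add: T'_def mod_simps)
  have "(\<Sum>i<n. of_bool (P (?h i)) + of_bool (T i \<noteq> (P (?h i) \<noteq> P (?h (Suc i mod n)))))
    = (\<Sum>i<n. of_bool (P (?h i)) + of_bool (T' (?h i) \<noteq> (P (?h i) \<noteq> P (Suc (?h i) mod n))) :: nat)"
    using T' by (intro sum.cong) (auto simp: mod_simps)
  also have "\<dots> = (\<Sum>i<n. of_bool (P i) + of_bool (T' i \<noteq> (P i \<noteq> P (Suc i mod n))))"
    by (rule sum_rotate[of "\<lambda>i. of_bool (P i) + of_bool (T' i \<noteq> (P i \<noteq> P (Suc i mod n)))"])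
  finally show ?thesis
    using that[of "\<lambda>i. P (?h i)", folded n_def] P sum_rotate[of "\<lambda>i. of_bool (P i) :: nat" "n - r" n]
    by simp
qed

lemma cheap_representative:
  fixes T :: "nat \<Rightarrow> bool"
  assumes m: "2 \<le> m"
  obtains P D where "odd (\<Sum>i<2 * m + 1. of_bool (P i) :: nat) \<longleftrightarrow> b"
    "(\<Sum>i<2 * m + 1. of_bool (P i) + of_bool (D i)
        + of_bool (T i \<noteq> ((P i \<noteq> P (Suc i mod (2 * m + 1)))
            \<noteq> (D i \<noteq> D ((i + 2) mod (2 * m + 1)))))) \<le> m + 1"
proof (cases "\<exists>r < 2 * m + 1. \<not> T r")
  case True
  then obtain r where "r < 2 * m + 1" "\<not> T r" by blast
  from cheap_outer_set[where T = T, OF m this, of b] show ?thesis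
    using that[of _ "\<lambda>_. False"] by auto
next
  case False
  \<comment> \<open>The outer edges 2, 4, ..., 2m settle all pentagons but 0, which takes inner edge
    0. If m has the wrong parity (\<open>c\<close>), spoke 2 replaces outer edge 2: it settles
    pentagons 0 and 2, and pentagon 1 takes inner edge 1.\<close>
  define c where "c \<longleftrightarrow> odd m \<noteq> b"
  define P where "P i \<longleftrightarrow> i \<noteq> 0 \<and> even i \<and> (c \<longrightarrow> i \<noteq> 2)" for i :: nat
  define D where "D i \<longleftrightarrow> i = 2 \<and> c" for i :: nat
  have P[simp]: "P 0 = False" "P (Suc (2 * k)) = False"
    "P (Suc (Suc (2 * k))) = (\<not> (k = 0 \<and> c))" "P (Suc 0) = False" "P (Suc (Suc 0)) = (\<not> c)" for k
    by (auto simp: P_def)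
  have D[simp]: "D 0 = False" "D (Suc (2 * k)) = False" "D (Suc (Suc (2 * k))) = (k = 0 \<and> c)"
    "D (Suc 0) = False" "D (Suc (Suc 0)) = c" for k
    by (auto simp: D_def)
  have T[simp]: "T 0" "k < m \<Longrightarrow> T (Suc (2 * k))" "k < m \<Longrightarrow> T (Suc (Suc (2 * k)))" for k
    using False by auto
  have next1[simp]: "Suc (Suc (Suc (2 * k))) mod Suc (2 * m)
      = (if Suc k = m then 0 else Suc (2 * Suc k))" if "k < m" for k
    using that by (auto simp: mod_if)
  have next2[simp]: "Suc (Suc (Suc (Suc (2 * k)))) mod Suc (2 * m)
      = (if Suc k = m then Suc 0 else Suc (Suc (2 * Suc k)))" if "k < m" for k
    using that m by (auto simp: mod_if)
  have one: "(\<Sum>k<m. of_bool (k = 0 \<and> c) :: nat) = of_bool c"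
    using m by (simp add: of_bool_conj sum.delta)
  have "(\<Sum>i<2 * m + 1. of_bool (P i) :: nat) = (\<Sum>k<m. of_bool (True \<noteq> (k = 0 \<and> c)))"
    unfolding sum_pairs by simp
  then have par: "odd (\<Sum>i<2 * m + 1. of_bool (P i) :: nat) \<longleftrightarrow> b"
    using odd_sum_of_bool_neq[of "\<lambda>_. True" "\<lambda>k. k = 0 \<and> c" m] one by (auto simp: c_def)
  let ?f = "\<lambda>i. of_bool (P i) + of_bool (D i)
        + of_bool (T i \<noteq> ((P i \<noteq> P (Suc i mod (2 * m + 1)))
            \<noteq> (D i \<noteq> D ((i + 2) mod (2 * m + 1))))) :: nat"
  have f0: "?f 0 = of_bool (\<not> c)"
    using m by (simp add: numeral_2_eq_2)
  have f: "?f (2 * k + 1) + ?f (2 * k + 2) = 1 + of_bool (k = 0 \<and> c)" if k: "k < m" for k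
  proof -
    define z where "z \<longleftrightarrow> k = 0 \<and> c"
    have z: "P (Suc (Suc (2 * k))) = (\<not> z)" "D (Suc (Suc (2 * k))) = z"
      by (simp_all add: z_def)
    have "P (Suc (Suc (Suc (2 * k))) mod Suc (2 * m)) = False"
      "D (Suc (Suc (Suc (2 * k))) mod Suc (2 * m)) = False"
      "D (Suc (Suc (Suc (Suc (2 * k)))) mod Suc (2 * m)) = False"
      using k by (simp_all del: mult_Suc_right)
    then show ?thesis
      using k by (cases z) (simp_all add: z z_def[symmetric] del: next1 next2 P(3) D(3))
  qed
  have "(\<Sum>i<2 * m + 1. ?f i) = ?f 0 + (\<Sum>k<m. ?f (2 * k + 1) + ?f (2 * k + 2))"
    by (rule sum_pairs)
  also have "(\<Sum>k<m. ?f (2 * k + 1) + ?f (2 * k + 2)) = (\<Sum>k<m. 1 + of_bool (k = 0 \<and> c))"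
    by (rule sum.cong[OF refl], rule f) (simp only: lessThan_iff)
  also have "?f 0 + \<dots> \<le> m + 1"
    unfolding f0 sum.distrib one by (cases c) simp_all
  finally show ?thesis using that[OF par] by blast
qed

section \<open>The three classes of edges\<close>

definition outer_edge :: "nat \<Rightarrow> nat \<Rightarrow> petersen_vertex set" where
  "outer_edge n i = {U i, U (Suc i mod n)}"

definition inner_edge :: "nat \<Rightarrow> nat \<Rightarrow> petersen_vertex set" where
  "inner_edge n i = {V i, V ((i + 2) mod n)}"

definition spoke :: "nat \<Rightarrow> petersen_vertex set" where
  "spoke i = {U i, V i}"

lemma edges_gen_petersen_2:
  "edges (gen_petersen n 2) =
     outer_edge n ` {..<n} \<union> inner_edge n ` {..<n} \<union> spoke ` {..<n}"
  by (auto simp: gen_petersen_def outer_edge_def inner_edge_def spoke_def)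

lemma inj_on_petersen_edges:
  assumes "5 \<le> n"
  shows "inj_on (outer_edge n) {..<n}" "inj_on (inner_edge n) {..<n}" "inj_on spoke {..<n}"
proof -
  show "inj_on (outer_edge n) {..<n}"
    using add_mod_twice_neq[of _ n 1] assms
    by (intro inj_onI) (auto simp: outer_edge_def doubleton_eq_iff)
  show "inj_on (inner_edge n) {..<n}"
  proof (rule inj_onI)
    fix i j assume ij: "i \<in> {..<n}" "j \<in> {..<n}" "inner_edge n i = inner_edge n j"
    then have "i = j \<or> i = (j + 2) mod n \<and> (i + 2) mod n = j"
      by (auto simp: inner_edge_def doubleton_eq_iff)
    then show "i = j"
      using add_mod_twice_neq[of j n 2] ij(2) assms by auto
  qed
  show "inj_on spoke {..<n}"
    by (auto simp: inj_on_def spoke_def doubleton_eq_iff)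
qed

lemma petersen_edges_disjoint:
  "outer_edge n i \<noteq> inner_edge n j" "outer_edge n i \<noteq> spoke j" "inner_edge n i \<noteq> spoke j"
  by (auto simp: outer_edge_def inner_edge_def spoke_def doubleton_eq_iff)

lemma sum_of_bool_eq_card:
  fixes n :: nat
  shows "(\<Sum>i<n. of_bool (p i) :: nat) = card {i. i < n \<and> p i}"
  by (simp add: sum_of_bool_eq lessThan_def Collect_conj_eq)

section \<open>Upper bound for every signing\<close>

text \<open>The given signing and the cheap one (\<open>P\<close>, \<open>D\<close>,
  \<open>B\<close>) differ by switching at a vertex set \<open>s\<close>. Hence deleting the
  negative edges of the cheap one leaves signs that \<open>s\<close> explains.\<close>

lemma frustration_index_gen_petersen_le:
  assumes m: "2 \<le> m"
  shows "frustration_index (gen_petersen (2 * m + 1) 2) N \<le> m + 1"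
proof -
  define n where "n = 2 * m + 1"
  have n: "5 \<le> n" using m by (simp add: n_def)
  define a where "a i \<longleftrightarrow> outer_edge n i \<in> N" for i
  define b where "b i \<longleftrightarrow> inner_edge n i \<in> N" for i
  define d where "d i \<longleftrightarrow> spoke i \<in> N" for i
  define T where "T i \<longleftrightarrow> b i \<noteq> ((a i \<noteq> a (Suc i mod n)) \<noteq> (d i \<noteq> d ((i + 2) mod n)))" for i
  obtain P D where par: "odd (\<Sum>i<n. of_bool (P i) :: nat) \<longleftrightarrow> odd (\<Sum>i<n. of_bool (a i) :: nat)"
    and cost: "(\<Sum>i<n. of_bool (P i) + of_bool (D i)
        + of_bool (T i \<noteq> ((P i \<noteq> P (Suc i mod n)) \<noteq> (D i \<noteq> D ((i + 2) mod n))))) \<le> m + 1"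
    using cheap_representative[OF m] unfolding n_def by blast
  \<comment> \<open>The inner sign forced by giving pentagon \<open>i\<close> its original sign
    \<open>T i\<close>.\<close>
  define B where "B i \<longleftrightarrow> T i \<noteq> ((P i \<noteq> P (Suc i mod n)) \<noteq> (D i \<noteq> D ((i + 2) mod n)))" for i
  \<comment> \<open>The potential on the outer cycle, obtained by summing the differences of the two
    signings from vertex 0 on.\<close>
  define x where "x i \<longleftrightarrow> odd (\<Sum>j<i. of_bool (a j \<noteq> P j) :: nat)" for i
  \<comment> \<open>The potential closes up because both signings give the outer cycle the same
    sign.\<close>
  have x_wrap: "x n = x 0"
    using par unfolding x_def odd_sum_of_bool_neq by simp
  have x_Suc: "x (Suc i mod n) = (x i \<noteq> (a i \<noteq> P i))" if "i < n" for i
  proof -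
    have "x (Suc i mod n) = x (Suc i)"
      using that x_wrap by (cases "Suc i = n") auto
    then show ?thesis by (auto simp: x_def)
  qed
  have x_Suc2: "x ((i + 2) mod n)
      = (x i \<noteq> ((a i \<noteq> P i) \<noteq> (a (Suc i mod n) \<noteq> P (Suc i mod n))))" if "i < n" for i
  proof -
    have "(i + 2) mod n = Suc (Suc i mod n) mod n" by (simp add: mod_simps)
    then show ?thesis using x_Suc[of "Suc i mod n"] x_Suc[OF that] n by auto
  qed
  \<comment> \<open>The value at \<open>V i\<close> is chosen so that spoke \<open>i\<close> is
    correct.\<close>
  define s where "s w = (case w of U i \<Rightarrow> x i | V i \<Rightarrow> x i \<noteq> (d i \<noteq> D i))" for w
  define F where "F = outer_edge n ` {i. i < n \<and> P i} \<union> spoke ` {i. i < n \<and> D i}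
      \<union> inner_edge n ` {i. i < n \<and> B i}"
  have outer: "a i \<longleftrightarrow> s (U i) \<noteq> s (U (Suc i mod n))" if "i < n" "\<not> P i" for i
    using x_Suc that by (auto simp: s_def)
  have sp: "d i \<longleftrightarrow> s (U i) \<noteq> s (V i)" if "\<not> D i" for i
    using that by (auto simp: s_def)
  \<comment> \<open>The signings agree on the sign of pentagon \<open>i\<close>, and
    \<open>s\<close> accounts for their difference on its other four edges, hence also on the inner
    edge.\<close>
  have inner: "b i \<longleftrightarrow> s (V i) \<noteq> s (V ((i + 2) mod n))" if "i < n" "\<not> B i" for i
    using x_Suc2[OF that(1)] that(2) unfolding s_def B_def T_def by auto
  have "frustration_index (gen_petersen n 2) N \<le> card F"
  proof (rule frustration_index_le_if_potential[where s = s])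
    show "finite (edges (gen_petersen n 2))" by (rule finite_edges_gen_petersen)
    show "F \<subseteq> edges (gen_petersen n 2)"
      unfolding F_def edges_gen_petersen_2 by auto
    fix y z
    assume e: "{y, z} \<in> edges (gen_petersen n 2) - F"
    then consider i where "{y, z} = outer_edge n i" "i < n" "\<not> P i"
      | i where "{y, z} = spoke i" "\<not> D i"
      | i where "{y, z} = inner_edge n i" "i < n" "\<not> B i"
      unfolding edges_gen_petersen_2 F_def by blast
    then show "{y, z} \<in> N \<longleftrightarrow> s y \<noteq> s z"
    proof cases
      case 1
      then have "{y, z} \<in> N \<longleftrightarrow> a i" by (simp add: a_def)
      with 1 outer[of i] show ?thesis
        by (auto simp: outer_edge_def doubleton_eq_iff)
    next
      case 2
      then have "{y, z} \<in> N \<longleftrightarrow> d i" by (simp add: d_def)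
      with 2 sp[of i] show ?thesis
        by (auto simp: spoke_def doubleton_eq_iff)
    next
      case 3
      then have "{y, z} \<in> N \<longleftrightarrow> b i" by (simp add: b_def)
      with 3 inner[of i] show ?thesis
        by (auto simp: inner_edge_def doubleton_eq_iff)
    qed
  qed
  also have "card F \<le> card {i. i < n \<and> P i} + card {i. i < n \<and> D i} + card {i. i < n \<and> B i}"
    unfolding F_def
    by (intro order_trans[OF card_Un_le] add_mono card_image_le) auto
  also have "\<dots> \<le> m + 1"
    using cost unfolding sum.distrib B_def[symmetric] sum_of_bool_eq_card .
  finally show ?thesis unfolding n_def .
qed

section \<open>Lower bound from the pentagons\<close>

text \<open>Double counting of incidences between deleted edges and pentagons. The factor 2
  postpones the rounding: for n = 2m + 1 the bound becomes m + 1.\<close>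

lemma frustration_index_all_negative_ge:
  assumes n: "5 \<le> n"
  shows "n \<le> 2 * frustration_index (gen_petersen n 2) (edges (gen_petersen n 2))"
proof -
  let ?G = "gen_petersen n 2"
  obtain F where F: "F \<subseteq> edges ?G" "balanced (delete_edges ?G F) (edges ?G - F)"
    and cF: "card F = frustration_index ?G (edges ?G)"
    using frustration_index_attained[OF finite_edges_gen_petersen] by metis
  have finF: "finite F" using F(1) finite_edges_gen_petersen finite_subset by blast
  let ?o = "\<lambda>i. of_bool (outer_edge n i \<in> F) :: nat"
    and ?i = "\<lambda>i. of_bool (inner_edge n i \<in> F) :: nat"
    and ?s = "\<lambda>i. of_bool (spoke i \<in> F) :: nat"
  have hit: "1 \<le> ?o i + ?o ((i + 1) mod n) + ?s i + ?s ((i + 2) mod n) + ?i i" if i: "i < n" for i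
  proof (rule ccontr)
    assume "\<not> ?thesis"
    then have notF: "outer_edge n i \<notin> F" "outer_edge n (Suc i mod n) \<notin> F" "spoke i \<notin> F"
      "spoke ((i + 2) mod n) \<notin> F" "inner_edge n i \<notin> F"
      by (auto split: if_splits)
    let ?vs = "[U i, U (Suc i mod n), U ((i + 2) mod n), V ((i + 2) mod n), V i]"
    have lt: "Suc i mod n < n" "(i + 2) mod n < n" using n by auto
    have ce: "cycle_edges ?vs = {outer_edge n i, outer_edge n (Suc i mod n),
        spoke ((i + 2) mod n), inner_edge n i, spoke i}"
      by (simp add: cycle_edges_image outer_edge_def inner_edge_def spoke_def mod_simps
          lessThan_Suc insert_commute)
    have dist: "distinct ?vs"
    proof -
      have "(i + 2) mod n = (Suc i mod n + 1) mod n" by (simp add: mod_simps)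
      then show ?thesis
        using add_mod_neq[of i n 1] add_mod_neq[of i n 2] add_mod_neq[of "Suc i mod n" n 1] i n lt
        by auto
    qed
    have sub: "cycle_edges ?vs \<subseteq> edges ?G - F"
      unfolding ce edges_gen_petersen_2 using notF i lt by auto
    then have "is_cycle (delete_edges ?G F) ?vs"
      using dist i lt by (auto simp: is_cycle_def delete_edges_def gen_petersen_def)
    with F(2) have "positive_cycle (edges ?G - F) ?vs" by (simp add: balanced_def)
    \<comment> \<open>A surviving pentagon would have sign (-1)^5.\<close>
    moreover have "(\<Prod>e \<in> cycle_edges ?vs. edge_sign (edges ?G - F) e)
        = (\<Prod>e \<in> cycle_edges ?vs. -1)"
      using sub by (intro prod.cong) (auto simp: edge_sign_def)
    moreover have "card (cycle_edges ?vs) = 5"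
      using card_cycle_edges[OF _ dist] by simp
    ultimately show False by (simp add: positive_cycle_def)
  qed
  have "n = (\<Sum>i<n. 1)" by simp
  also have "\<dots> \<le> (\<Sum>i<n. ?o i + ?o ((i + 1) mod n) + ?s i + ?s ((i + 2) mod n) + ?i i)"
    using hit by (intro sum_mono) auto
  \<comment> \<open>Outer edges and spokes lie on two of the pentagons, inner edges on one.\<close>
  also have "\<dots> = 2 * (\<Sum>i<n. ?o i) + 2 * (\<Sum>i<n. ?s i) + (\<Sum>i<n. ?i i)"
    unfolding sum.distrib sum_rotate[of ?o] sum_rotate[of ?s] by simp
  also have "\<dots> \<le> 2 * ((\<Sum>i<n. ?o i) + (\<Sum>i<n. ?s i) + (\<Sum>i<n. ?i i))" by simp
  also have "(\<Sum>i<n. ?o i) + (\<Sum>i<n. ?s i) + (\<Sum>i<n. ?i i) \<le> card F"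
  proof -
    let ?A = "outer_edge n ` {i. i < n \<and> outer_edge n i \<in> F}"
      and ?B = "spoke ` {i. i < n \<and> spoke i \<in> F}"
      and ?C = "inner_edge n ` {i. i < n \<and> inner_edge n i \<in> F}"
    have "(\<Sum>i<n. ?o i) + (\<Sum>i<n. ?s i) + (\<Sum>i<n. ?i i) = card ?A + card ?B + card ?C"
      unfolding sum_of_bool_eq_card
      by (simp add: card_image inj_on_subset[OF inj_on_petersen_edges(1)[OF n]]
          inj_on_subset[OF inj_on_petersen_edges(2)[OF n]]
          inj_on_subset[OF inj_on_petersen_edges(3)[OF n]] subset_eq)
    also have "\<dots> = card (?A \<union> ?B \<union> ?C)"
      using petersen_edges_disjoint
      by (subst card_Un_disjoint; (subst card_Un_disjoint)?) (auto, metis+)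
    also have "\<dots> \<le> card F" using finF by (intro card_mono) auto
    finally show ?thesis .
  qed
  finally show ?thesis using cF by simp
qed

theorem theorem3p7:
  fixes m :: nat
  assumes "m \<ge> 2"
  shows "max_frustration (gen_petersen (2 * m + 1) 2) = m + 1"
proof (rule antisym)
  let ?G = "gen_petersen (2 * m + 1) 2"
  have fin: "finite (frustration_index ?G ` Pow (edges ?G))"
    by (simp add: finite_edges_gen_petersen)
  show "max_frustration ?G \<le> m + 1"
    unfolding max_frustration_def using fin frustration_index_gen_petersen_le[OF assms]
    by (subst Max_le_iff) auto
  have "frustration_index ?G (edges ?G) \<le> max_frustration ?G"
    unfolding max_frustration_def using fin by (intro Max_ge) auto
  then show "m + 1 \<le> max_frustration ?G"
    using frustration_index_all_negative_ge[of "2 * m + 1"] assms by simp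
qed

end
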